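(* Let $D_5=(V,A)$ be the digraph with vertex set $V=\{v_1,v_2,v_3,v_4,v_5,v_6,v_7\}$ and arc set $A=\{(v_2,v_1),(v_2,v_3),(v_4,v_1),(v_4,v_3),(v_5,v_2),(v_5,v_3),(v_5,v_4),(v_6,v_1),(v_6,v_2),(v_6,v_3),(v_7,v_5),(v_7,v_6)\}$ (where $v_1,\dots,v_7$ represent holomorphic, CR, anti-invariant, slant, semi-slant, hemi-slant and bi-slant submanifolds of almost Hermitian manifolds, respectively). Then: (i) $D_5$ is a three-partite digraph; (ii) the maximum size of a matching of $D_5$ is $3$; (iii) the independence number of $D_5$ is $3$; (iv) the chromatic number of $D_5$ is $3$; (v) $D_5$ has a directed spanning tree; (vi) the domination number of $D_5$ is $3$.
   Context: An arc $(u,v)$ goes from $u$ to $v$. The geometric meaning of the vertices plays no role in the statement; the digraph is the explicit one given. Definitions for a digraph $D=(V,A)$: - $D$ is $p$-partite if $V$ can be partitioned into $p$ nonempty sets such that no arc joins two vertices of the same set. - A matching is a set of arcs, none a loop, no two of which share an end-vertex. - A set of vertices is independent if there are no arcs between its members. The independence number is the maximum size of an independent set. The chromatic number is the minimum number of sets in a partition of $V$ into independent sets. - A directed spanning tree of $D$ with root $r\in V$ is a subdigraph $T$ of $D$ with $V(T)=V$ whose underlying undirected graph is a tree and in which there is a unique directed path from $r$ to each $v\in V\setminus\{r\}$. "$D$ has a directed spanning tree" means one exists for some root $r$. - A dominating set is a set $S\subseteq V$ such that for every $v\in V\setminus S$ there is $u\in S$ with $(u,v)\in A$. The domination number is the minimum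 cardinality of a dominating set. *)

theory Defs
  imports "Graph_Theory.Graph_Theory" "HOL-Library.Disjoint_Sets"
begin

text \<open>The numerical invariants below are intended for finite digraphs.\<close>

definition independent_set :: "('a, 'b) pre_digraph \<Rightarrow> 'a set \<Rightarrow> bool" where
  "independent_set D S \<longleftrightarrow> S \<subseteq> verts D \<and> (\<forall>u\<in>S. \<forall>v\<in>S. \<not> u \<rightarrow>\<^bsub>D\<^esub> v)"

definition independence_number :: "('a, 'b) pre_digraph \<Rightarrow> nat" where
  "independence_number D = Max {card S | S. independent_set D S}"

text \<open>The classes of a \<^const>\<open>partition_on\<close> are nonempty.\<close>

definition independent_partition :: "('a, 'b) pre_digraph \<Rightarrow> 'a set set \<Rightarrow> bool" where
  "independent_partition D P \<longleftrightarrow> partition_on (verts D) P \<and> (\<forall>S\<in>P. independent_set D S)"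

definition partite :: "nat \<Rightarrow> ('a, 'b) pre_digraph \<Rightarrow> bool" where
  "partite p D \<longleftrightarrow> (\<exists>P. independent_partition D P \<and> finite P \<and> card P = p)"

definition chromatic_number :: "('a, 'b) pre_digraph \<Rightarrow> nat" where
  "chromatic_number D = (LEAST k. \<exists>P. independent_partition D P \<and> finite P \<and> card P = k)"

definition matching :: "('a, 'b) pre_digraph \<Rightarrow> 'b set \<Rightarrow> bool" where
  "matching D M \<longleftrightarrow> M \<subseteq> arcs D \<and> (\<forall>e\<in>M. tail D e \<noteq> head D e) \<and>
     (\<forall>e\<in>M. \<forall>f\<in>M. e \<noteq> f \<longrightarrow> {tail D e, head D e} \<inter> {tail D f, head D f} = {})"

definition matching_number :: "('a, 'b) pre_digraph \<Rightarrow> nat" where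
  "matching_number D = Max {card M | M. matching D M}"

definition dominating_set :: "('a, 'b) pre_digraph \<Rightarrow> 'a set \<Rightarrow> bool" where
  "dominating_set D S \<longleftrightarrow> S \<subseteq> verts D \<and> (\<forall>v\<in>verts D - S. \<exists>u\<in>S. u \<rightarrow>\<^bsub>D\<^esub> v)"

definition domination_number :: "('a, 'b) pre_digraph \<Rightarrow> nat" where
  "domination_number D = (LEAST k. \<exists>S. dominating_set D S \<and> finite S \<and> card S = k)"

text \<open>
  The constant \<^const>\<open>tree\<close> does not say that the underlying undirected graph is a tree:
  it only excludes directed cycles.  The underlying undirected (simple) graph of \<open>T\<close> is
  represented by the symmetric digraph \<^term>\<open>mk_symmetric T\<close>.  There, going along an edge
  and straight back is a \<open>cycle\<close> of length 2; every \<open>cycle\<close> of another length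
  is a loop or a genuine undirected cycle.
\<close>

definition underlying_tree :: "('a, 'b) pre_digraph \<Rightarrow> bool" where
  "underlying_tree T \<longleftrightarrow> connected T \<and>
     \<not> (\<exists>p. pre_digraph.cycle (with_proj (mk_symmetric T)) p \<and> length p \<noteq> 2)"

definition directed_spanning_tree ::
    "('a, 'b) pre_digraph \<Rightarrow> 'a \<Rightarrow> ('a, 'b) pre_digraph \<Rightarrow> bool" where
  "directed_spanning_tree D r T \<longleftrightarrow> r \<in> verts D \<and> spanning T D \<and> underlying_tree T \<and>
     (\<forall>v\<in>verts D - {r}. \<exists>!p. pre_digraph.apath T r p v)"

text \<open>
  The vertices stand for the following classes of submanifolds of almost Hermitian manifolds:
  holomorphic, CR, anti-invariant, slant, semi-slant, hemi-slant and bi-slant, in this order.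
\<close>

datatype vertex = v1 | v2 | v3 | v4 | v5 | v6 | v7

definition D5 :: "(vertex, vertex \<times> vertex) pre_digraph" where
  "D5 = with_proj
     \<lparr> pverts = {v1, v2, v3, v4, v5, v6, v7},
       parcs = {(v2, v1), (v2, v3), (v4, v1), (v4, v3), (v5, v2), (v5, v3), (v5, v4),
                (v6, v1), (v6, v2), (v6, v3), (v7, v5), (v7, v6)} \<rparr>"

lemma digraph_D5: "digraph D5"
  by unfold_locales (auto simp: D5_def arc_to_ends_def)

end

theory Submission
  imports Defs
begin

text \<open>Each invariant gets an explicit witness and a short certificate of optimality. Seven
  vertices leave room for at most three disjoint arcs (\<open>two_times_card_matching_le\<close>).
  The cliques \<open>{v2, v3, v5}\<close>, \<open>{v1, v4}\<close>, \<open>{v6, v7}\<close> cover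
  the vertices and each meets an independent set at most once
  (\<open>card_independent_Int_clique_le\<close>); the first, a triangle, forces three colours
  (\<open>card_clique_le_card_independent_partition\<close>). A dominating set contains the source
  \<open>v7\<close>, and the in-neighbours of \<open>v1\<close>, \<open>v2\<close>,
  \<open>v4\<close> force two more members.

  The spanning tree rests on \<open>directed_spanning_treeI\<close>: if every arc raises a height
  and each vertex other than the root has exactly one in-arc (the root at most one), then tracing
  in-arcs backwards yields a unique path from the root, and no undirected cycle can exist.\<close>

section \<open>Directed trees from a height function\<close>

text \<open>Each arc gains at least one unit of height. The case \<open>u = v\<close> excludes
  nonempty closed walks.\<close>

lemma awalk_ascending_height:
  fixes h :: "'a \<Rightarrow> nat"
  assumes "wf_digraph T" "\<And>e. e \<in> arcs T \<Longrightarrow> h (tail T e) < h (head T e)"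
    and "pre_digraph.awalk T u p v"
  shows "h u + length p \<le> h v"
proof -
  interpret wf_digraph T by fact
  show ?thesis
    using assms(3)
  proof (induction p arbitrary: u)
    case (Cons e p)
    then show ?case
      using assms(2)[of e] by (fastforce simp: awalk_Cons_iff)
  qed (simp add: awalk_Nil_iff)
qed

text \<open>
  A vertex of maximal height on a cycle has both its cyclic neighbours of smaller height, so
  both coincide with its unique predecessor.
\<close>

lemma cycle_mk_symmetric_length:
  fixes h :: "'a \<Rightarrow> nat"
  assumes "wf_digraph T"
    and asc: "\<And>e. e \<in> arcs T \<Longrightarrow> h (tail T e) < h (head T e)"
    and uniq: "\<And>e f. e \<in> arcs T \<Longrightarrow> f \<in> arcs T \<Longrightarrow> head T e = head T f \<Longrightarrow> e = f"
    and cyc: "pre_digraph.cycle (with_proj (mk_symmetric T)) p"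
  shows "length p = 2"
proof -
  interpret wf_digraph T by fact
  interpret S: pair_wf_digraph "mk_symmetric T" ..
  define n where "n = length p"
  obtain u where walk: "S.awalk u p u" and dist: "distinct (tl (S.awalk_verts u p))" and "p \<noteq> []"
    using cyc unfolding S.cycle_def by blast
  have cas: "S.cas u p u"
    using walk by (auto simp: S.awalk_def)
  have verts: "S.awalk_verts u p = u # map snd p"
    using S.awalk_verts_conv'[of u p u] cas \<open>p \<noteq> []\<close> by (auto simp: S.cas_simp)
  have dist': "distinct (map snd p)"
    using dist verts by simp
  have "n > 0"
    using \<open>p \<noteq> []\<close> by (simp add: n_def)
  \<comment> \<open>Positions are read modulo \<open>n\<close>; the wrap-around case holds because
    the walk both starts and ends at \<open>u\<close>.\<close>
  have link: "fst (p ! (Suc i mod n)) = snd (p ! i)" if "i < n" for i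
  proof (cases "Suc i < n")
    case True
    have "map fst p @ [snd (last p)] = u # map snd p"
      using S.awalk_verts_conv[of u p] verts \<open>p \<noteq> []\<close> by simp
    then have "(map fst p @ [snd (last p)]) ! Suc i = (u # map snd p) ! Suc i"
      by simp
    then show ?thesis
      using True by (simp add: n_def nth_append)
  next
    case False
    then have i: "i = n - 1"
      using that by simp
    have "fst (hd p) = u" "snd (last p) = u"
      using cas verts \<open>p \<noteq> []\<close> S.awlast_of_awalk[OF walk]
      by (auto simp: S.cas_simp last_map)
    then show ?thesis
      using i \<open>n > 0\<close> \<open>p \<noteq> []\<close> by (simp add: n_def hd_conv_nth last_conv_nth)
  qed
  let ?H = "(\<lambda>j. h (snd (p ! j))) ` {..<n}"
  have "Max ?H \<in> ?H"
    using \<open>n > 0\<close> by (intro Max_in) auto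
  then obtain i where i: "i < n" and "Max ?H = h (snd (p ! i))"
    by auto
  then have max: "h (snd (p ! j)) \<le> h (snd (p ! i))" if "j < n" for j
    using Max_ge[of ?H "h (snd (p ! j))"] that by auto
  define k where "k = Suc i mod n"
  have k: "k < n"
    using \<open>n > 0\<close> by (simp add: k_def)
  obtain j where j: "j < n" "i = Suc j mod n"
  proof (cases i)
    case 0
    then show thesis using that[of "n - 1"] \<open>n > 0\<close> by simp
  next
    case (Suc m)
    then show thesis using that[of m] i by simp
  qed
  have arc_in: "p ! l \<in> parcs (mk_symmetric T)" if "l < n" for l
    using walk that by (auto simp: S.awalk_def n_def)
  \<comment> \<open>Arcs of \<open>mk_symmetric T\<close> are arcs of \<open>T\<close> up to
    orientation; since the head of \<open>p ! i\<close> has maximal height, \<open>e\<close> and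
    \<open>f\<close> must both point to it.\<close>
  obtain e where e: "e \<in> arcs T" "{fst (p ! i), snd (p ! i)} = {tail T e, head T e}"
    using arc_in[OF i] by (force simp: parcs_mk_symmetric)
  obtain f where f: "f \<in> arcs T" "{fst (p ! k), snd (p ! k)} = {tail T f, head T f}"
    using arc_in[OF k] by (force simp: parcs_mk_symmetric)
  have "fst (p ! i) = snd (p ! j)"
    using link[OF j(1)] j(2) by simp
  then have e': "head T e = snd (p ! i)" "tail T e = snd (p ! j)"
    using e asc[OF e(1)] max[OF j(1)] by (auto simp: doubleton_eq_iff)
  have "fst (p ! k) = snd (p ! i)"
    using link[OF i] by (simp add: k_def)
  then have f': "head T f = snd (p ! i)" "tail T f = snd (p ! k)"
    using f asc[OF f(1)] max[OF k] by (auto simp: doubleton_eq_iff)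
  have "e = f"
    using uniq e f e' f' by simp
  then have "snd (p ! j) = snd (p ! k)"
    using e' f' by simp
  then have "j = k"
    using dist' j(1) k by (simp add: distinct_conv_nth n_def) metis
  moreover have "i \<noteq> j"
    using e' asc[OF e(1)] by auto
  \<comment> \<open>Now \<open>i\<close> and \<open>j\<close> are cyclic successors of each other,
    so \<open>n\<close> divides 2, and \<open>n = 1\<close> would give \<open>i = j\<close>.\<close>
  ultimately show ?thesis
    using i j unfolding k_def n_def[symmetric] by (auto simp: mod_Suc split: if_splits)
qed

text \<open>Read backwards from \<open>v\<close>, both walks must use the same in-arc at every step;
  neither can stop at \<open>r\<close> before the other, as a nonempty closed walk would gain
  height.\<close>

lemma apath_unique:
  fixes h :: "'a \<Rightarrow> nat"
  assumes "wf_digraph T"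
    and asc: "\<And>e. e \<in> arcs T \<Longrightarrow> h (tail T e) < h (head T e)"
    and uniq: "\<And>e f. e \<in> arcs T \<Longrightarrow> f \<in> arcs T \<Longrightarrow> head T e = head T f \<Longrightarrow> e = f"
    and "pre_digraph.awalk T r p v" "pre_digraph.awalk T r q v"
  shows "p = q"
proof -
  interpret wf_digraph T by fact
  note closed = awalk_ascending_height[OF assms(1) asc]
  show ?thesis
    using assms(4,5)
  proof (induction p arbitrary: q v rule: rev_induct)
    case Nil
    then show ?case
      using closed[of r q v] by (auto simp: awalk_Nil_iff)
  next
    case (snoc e p)
    show ?case
    proof (cases q rule: rev_exhaust)
      case Nil
      then show ?thesis
        using closed[of r "p @ [e]" v] snoc.prems by (auto simp: awalk_Nil_iff)
    next
      case (snoc q' f)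
      then have "e = f" "awalk r p (tail T e)" "awalk r q' (tail T f)"
        using snoc.prems uniq[of e f] by (auto simp: awalk_simps)
      then show ?thesis
        using snoc snoc.IH by blast
    qed
  qed
qed

lemma directed_spanning_treeI:
  fixes h :: "'a \<Rightarrow> nat"
  assumes span: "spanning T D" and r: "r \<in> verts D"
    and asc: "\<And>e. e \<in> arcs T \<Longrightarrow> h (tail T e) < h (head T e)"
    and uniq: "\<And>e f. e \<in> arcs T \<Longrightarrow> f \<in> arcs T \<Longrightarrow> head T e = head T f \<Longrightarrow> e = f"
    and pred: "\<And>v. v \<in> verts D \<Longrightarrow> v \<noteq> r \<Longrightarrow> \<exists>e\<in>arcs T. head T e = v"
  shows "directed_spanning_tree D r T"
proof -
  have wf: "wf_digraph T" and V: "verts T = verts D"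
    using span by (auto simp: spanning_def subgraph_def)
  interpret wf_digraph T by fact
  interpret S: pair_wf_digraph "mk_symmetric T" ..
  have reach: "r \<rightarrow>\<^sup>*\<^bsub>T\<^esub> v" if "v \<in> verts D" for v
    using that
  \<comment> \<open>The tail of an in-arc of \<open>v\<close> has smaller height, so tracing in-arcs
    backwards terminates, and it can only end at \<open>r\<close>.\<close>
  proof (induction "h v" arbitrary: v rule: less_induct)
    case less
    show ?case
    proof (cases "v = r")
      case True
      then show ?thesis using r V by simp
    next
      case False
      then obtain e where e: "e \<in> arcs T" "head T e = v"
        using pred less.prems by blast
      then have "r \<rightarrow>\<^sup>*\<^bsub>T\<^esub> tail T e"
        using less.hyps asc V tail_in_verts by metis
      then show ?thesis
        using e by (metis in_arcs_imp_in_arcs_ends reachable_adj_trans)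
    qed
  qed
  have "connected T"
    unfolding connected_def strongly_connected_def
  proof (intro conjI ballI)
    show "verts (with_proj (mk_symmetric T)) \<noteq> {}"
      using r V by auto
    fix u v
    assume "u \<in> verts (with_proj (mk_symmetric T))" "v \<in> verts (with_proj (mk_symmetric T))"
    then have "r \<rightarrow>\<^sup>*\<^bsub>mk_symmetric T\<^esub> u" "r \<rightarrow>\<^sup>*\<^bsub>mk_symmetric T\<^esub> v"
      using reach V reachable_mk_symmetricI by auto
    then show "u \<rightarrow>\<^sup>*\<^bsub>mk_symmetric T\<^esub> v"
      by (metis S.reachable_trans symmetric_mk_symmetric symmetric_reachable S.wf_digraph)
  qed
  moreover have "\<exists>!p. apath r p v" if "v \<in> verts D" for v
    using reach[OF that] apath_unique[OF wf asc uniq] unfolding reachable_apath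
    by (metis apath_def)
  ultimately show ?thesis
    unfolding directed_spanning_tree_def underlying_tree_def
    using span r cycle_mk_symmetric_length[OF wf asc uniq] by blast
qed

section \<open>Bounds from matchings and cliques\<close>

text \<open>The end-vertices of the arcs of \<open>M\<close> form pairwise disjoint two-element sets
  of vertices.\<close>

lemma two_times_card_matching_le:
  assumes "fin_digraph D" "matching D M"
  shows "2 * card M \<le> card (verts D)"
proof -
  interpret fin_digraph D by fact
  let ?ends = "\<lambda>e. {tail D e, head D e}"
  have sub: "M \<subseteq> arcs D"
    using assms(2) by (simp add: matching_def)
  have "card (\<Union>e\<in>M. ?ends e) = (\<Sum>e\<in>M. card (?ends e))"
    using assms(2) finite_subset[OF sub] by (intro card_UN_disjoint) (auto simp: matching_def)
  also have "\<dots> = (\<Sum>e\<in>M. 2)"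
    using assms(2) by (intro sum.cong) (auto simp: matching_def)
  finally have "card (\<Union>e\<in>M. ?ends e) = 2 * card M"
    by simp
  moreover have "(\<Union>e\<in>M. ?ends e) \<subseteq> verts D"
    using sub by auto
  ultimately show ?thesis
    using card_mono[OF finite_verts] by metis
qed

text \<open>Adjacency counts in either direction, so this is a clique of the underlying undirected
  graph.\<close>

definition clique :: "('a, 'b) pre_digraph \<Rightarrow> 'a set \<Rightarrow> bool" where
  "clique D K \<longleftrightarrow>
    K \<subseteq> verts D \<and> (\<forall>u\<in>K. \<forall>v\<in>K. u \<noteq> v \<longrightarrow> u \<rightarrow>\<^bsub>D\<^esub> v \<or> v \<rightarrow>\<^bsub>D\<^esub> u)"

lemma independent_clique_eq:
  assumes "independent_set D S" "clique D K" "u \<in> S \<inter> K" "v \<in> S \<inter> K"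
  shows "u = v"
  using assms unfolding independent_set_def clique_def by blast

lemma card_independent_Int_clique_le:
  assumes "independent_set D S" "clique D K"
  shows "card (S \<inter> K) \<le> 1"
\<comment> \<open>An infinite set has \<open>card\<close> 0, which settles the other case.\<close>
proof (cases "finite (S \<inter> K)")
  case True
  then show ?thesis
    using independent_clique_eq[OF assms] by (simp only: One_nat_def card_le_Suc0_iff_eq) blast
qed simp

text \<open>Sending each clique vertex to a class containing it is injective, since an independent
  class holds at most one of them.\<close>

lemma card_clique_le_card_independent_partition:
  assumes "independent_partition D P" "finite P" "clique D K"
  shows "card K \<le> card P"
proof -
  have "\<forall>v\<in>K. \<exists>S\<in>P. v \<in> S"
    using assms(1,3) by (auto simp: independent_partition_def partition_on_def clique_def)
  then obtain c where c: "\<And>v. v \<in> K \<Longrightarrow> c v \<in> P \<and> v \<in> c v"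
    by metis
  have "inj_on c K"
  proof (rule inj_onI)
    fix u v assume "u \<in> K" "v \<in> K" "c u = c v"
    then show "u = v"
      using c[of u] c[of v] independent_clique_eq[of D "c u" K u v] assms(1,3)
      by (auto simp: independent_partition_def)
  qed
  then show ?thesis
    using c assms(2) by (intro card_inj_on_le) auto
qed

section \<open>The invariants of \<open>D5\<close>\<close>

lemma verts_D5: "verts D5 = {v1, v2, v3, v4, v5, v6, v7}"
  by (simp add: D5_def)

lemma arcs_D5: "arcs D5 = {(v2, v1), (v2, v3), (v4, v1), (v4, v3), (v5, v2), (v5, v3), (v5, v4),
                (v6, v1), (v6, v2), (v6, v3), (v7, v5), (v7, v6)}"
  by (simp add: D5_def)

lemma ends_D5: "tail D5 = fst" "head D5 = snd"
  by (simp_all add: D5_def)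

lemma arcs_ends_D5: "arcs_ends D5 = arcs D5"
  by (simp add: D5_def)

text \<open>This partition witnesses both three-partiteness and the upper bound on the chromatic
  number; its class \<open>{v2, v4, v7}\<close> is a largest independent set.\<close>

lemma independent_partition_D5: "independent_partition D5 {{v1, v3}, {v2, v4, v7}, {v5, v6}}"
  by (auto simp: independent_partition_def independent_set_def partition_on_def disjoint_def
      arcs_ends_D5 arcs_D5 verts_D5)

lemma partite_D5: "partite 3 D5"
  unfolding partite_def
  by (intro exI[of _ "{{v1, v3}, {v2, v4, v7}, {v5, v6}}"])
     (auto simp: independent_partition_D5 card_insert_if set_eq_iff)

text \<open>Together the three cliques cover all vertices, which bounds independent sets; the
  triangle alone bounds the number of colours.\<close>

lemma cliques_D5: "clique D5 {v2, v3, v5}" "clique D5 {v1, v4}" "clique D5 {v6, v7}"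
  by (simp_all add: clique_def verts_D5 arcs_ends_D5 arcs_D5)

lemma chromatic_number_D5: "chromatic_number D5 = 3"
  unfolding chromatic_number_def
proof (rule Least_equality)
  show "\<exists>P. independent_partition D5 P \<and> finite P \<and> card P = 3"
    using partite_D5 by (simp add: partite_def)
next
  fix k assume "\<exists>P. independent_partition D5 P \<and> finite P \<and> card P = k"
  then obtain P where "independent_partition D5 P" "finite P" "card P = k"
    by blast
  then show "3 \<le> k"
    using card_clique_le_card_independent_partition[OF _ _ cliques_D5(1)] by fastforce
qed

lemma matching_number_D5: "matching_number D5 = 3"
  unfolding matching_number_def
proof (rule Max_eqI)
  interpret digraph D5 by (rule digraph_D5)
  have le: "card M \<le> 3" if "matching D5 M" for M
    using two_times_card_matching_le[OF fin_digraph_axioms that] by (simp add: verts_D5)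
  \<comment> \<open>The uniform bound makes the set of sizes finite, as \<open>Max\<close>
    requires.\<close>
  show "finite {card M |M. matching D5 M}"
    by (rule finite_subset[of _ "{..3}"]) (auto dest: le)
  show "y \<le> 3" if "y \<in> {card M |M. matching D5 M}" for y
    using that le by blast
  have "matching D5 {(v2, v1), (v4, v3), (v7, v5)}"
    by (auto simp: matching_def arcs_D5 ends_D5)
  then show "3 \<in> {card M |M. matching D5 M}"
    by (force intro: exI[of _ "{(v2, v1), (v4, v3), (v7, v5)}"])
qed

lemma independence_number_D5: "independence_number D5 = 3"
  unfolding independence_number_def
proof (rule Max_eqI)
  have le: "card S \<le> 3" if S: "independent_set D5 S" for S
  proof -
    have "S = S \<inter> {v2, v3, v5} \<union> S \<inter> {v1, v4} \<union> S \<inter> {v6, v7}"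
      using S by (auto simp: independent_set_def verts_D5)
    then have "card S \<le> card (S \<inter> {v2, v3, v5}) + card (S \<inter> {v1, v4}) + card (S \<inter> {v6, v7})"
      by (metis (no_types, lifting) add_le_mono1 card_Un_le order_trans)
    moreover have "card (S \<inter> {v2, v3, v5}) \<le> 1" "card (S \<inter> {v1, v4}) \<le> 1" "card (S \<inter> {v6, v7}) \<le> 1"
      using card_independent_Int_clique_le[OF S] cliques_D5 by blast+
    ultimately show ?thesis by linarith
  qed
  show "finite {card S |S. independent_set D5 S}"
    by (rule finite_subset[of _ "{..3}"]) (auto dest: le)
  show "y \<le> 3" if "y \<in> {card S |S. independent_set D5 S}" for y
    using that le by blast
  have "independent_set D5 {v2, v4, v7}"
    using independent_partition_D5 by (simp add: independent_partition_def)
  then show "3 \<in> {card S |S. independent_set D5 S}"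
    by (force intro: exI[of _ "{v2, v4, v7}"])
qed

lemma domination_number_D5: "domination_number D5 = 3"
  unfolding domination_number_def
proof (rule Least_equality)
  have "dominating_set D5 {v5, v6, v7}"
    by (auto simp: dominating_set_def verts_D5 arcs_ends_D5 arcs_D5)
  then show "\<exists>S. dominating_set D5 S \<and> finite S \<and> card S = 3"
    by (intro exI[of _ "{v5, v6, v7}"]) simp
next
  fix k assume "\<exists>S. dominating_set D5 S \<and> finite S \<and> card S = k"
  then obtain S where S: "dominating_set D5 S" and fin: "finite S" "card S = k"
    by blast
  have dom: "v \<in> S \<or> (\<exists>u\<in>S. (u, v) \<in> arcs D5)" for v
    using S by (cases v) (auto simp: dominating_set_def verts_D5 arcs_ends_D5)
  \<comment> \<open>\<open>v7\<close> has no in-arc; the disjunctions list \<open>v4\<close>,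
    \<open>v1\<close>, \<open>v2\<close> with their in-neighbours.\<close>
  have "v7 \<in> S" "v4 \<in> S \<or> v5 \<in> S" "v1 \<in> S \<or> v2 \<in> S \<or> v4 \<in> S \<or> v6 \<in> S"
    "v2 \<in> S \<or> v5 \<in> S \<or> v6 \<in> S"
    using dom[of v7] dom[of v4] dom[of v1] dom[of v2] by (auto simp: arcs_D5)
  \<comment> \<open>If \<open>v4\<close> is in \<open>S\<close>, the condition from
    \<open>v2\<close> supplies another member; if \<open>v5\<close> is, the condition from
    \<open>v1\<close> does.\<close>
  then obtain x y where "{x, y, v7} \<subseteq> S" "x \<noteq> y" "x \<noteq> v7" "y \<noteq> v7"
    by (auto 0 4)
  then show "3 \<le> k"
    using card_mono[of S "{x, y, v7}"] fin by simp
qed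

lemma directed_spanning_tree_D5: "\<exists>T. directed_spanning_tree D5 v7 T"
proof -
  define T where "T = with_proj \<lparr> pverts = {v1, v2, v3, v4, v5, v6, v7},
    parcs = {(v7, v5), (v7, v6), (v5, v2), (v5, v3), (v5, v4), (v6, v1)} \<rparr>"
  have arcs_T: "arcs T = {(v7, v5), (v7, v6), (v5, v2), (v5, v3), (v5, v4), (v6, v1)}"
    and ends_T: "tail T = fst" "head T = snd"
    and verts_T: "verts T = verts D5"
    by (simp_all add: T_def verts_D5)
  have wf: "wf_digraph T"
    by unfold_locales (auto simp: arcs_T ends_T verts_T verts_D5)
  interpret digraph D5 by (rule digraph_D5)
  have span: "spanning T D5"
    using wf wf_digraph_axioms
    by (auto simp: spanning_def subgraph_def compatible_def verts_T arcs_T arcs_D5 ends_T ends_D5)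
  \<comment> \<open>The depth in \<open>T\<close>, counted from the root \<open>v7\<close>.\<close>
  define h :: "vertex \<Rightarrow> nat" where
    "h v = (if v = v7 then 0 else if v \<in> {v5, v6} then 1 else 2)" for v
  have "directed_spanning_tree D5 v7 T"
    by (rule directed_spanning_treeI[OF span, where h = h])
       (auto simp: verts_D5 arcs_T ends_T h_def)
  then show ?thesis ..
qed

theorem theorem3p5:
  shows "partite 3 D5 \<and>
    matching_number D5 = 3 \<and>
    independence_number D5 = 3 \<and>
    chromatic_number D5 = 3 \<and>
    (\<exists>r T. directed_spanning_tree D5 r T) \<and>
    domination_number D5 = 3"
  using partite_D5 matching_number_D5 independence_number_D5 chromatic_number_D5
    directed_spanning_tree_D5 domination_number_D5 by blast

end
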